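(* Let $\nu$ be a random variable with $\mathbf{P}(\nu=j)>0$ for all $j\in\mathbb{N}=\{1,2,\dots\}$ and $\sum_{j\ge1}\mathbf{P}(\nu=j)=1$, let $F(j)=\mathbf{P}(\nu\le j)$, $F(0)=0$, and let $\{X_n\}$ be the Lamperti maximal branching process with branching number $\nu$, i.e. the Markov chain on $\mathbb{N}$ with transition matrix $P(i,j)=F(j)^i-F(j-1)^i$, $i,j\ge1$. If $\{X_n\}$ is null recurrent, then it has a non-trivial ($\ne\mathbf{0}$) invariant positive measure: there is $\mathbf{\delta}=(\delta(j))_{j\ge1}$ with $0<\delta(j)<\infty$ and $\delta(j)=\sum_{i\ge1}\delta(i)P(i,j)$ for all $j\ge1$.
   Context: The Lamperti maximal branching process is defined by $X_{n+1}=\max_{j=1,\dots,X_n}\nu_{j,n+1}$ where the $\nu_{j,n+1}$ are i.i.d. copies of $\nu$. *)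

theory Defs
  imports "HOL-Probability.Probability"
begin

definition markov_chain ::
  "'w measure \<Rightarrow> 's set \<Rightarrow> ('s \<Rightarrow> 's \<Rightarrow> real) \<Rightarrow> (nat \<Rightarrow> 'w \<Rightarrow> 's) \<Rightarrow> bool" where
  "markov_chain M S P X \<longleftrightarrow>
     prob_space M \<and>
     (\<forall>n. X n \<in> measurable M (count_space S)) \<and>
     (\<forall>n x y. (\<forall>k\<le>n. x k \<in> S) \<longrightarrow> y \<in> S \<longrightarrow>
        \<P>(\<omega> in M. \<forall>k\<le>n. X k \<omega> = x k) > 0 \<longrightarrow>
        \<P>(\<omega> in M. X (Suc n) \<omega> = y \<bar> \<forall>k\<le>n. X k \<omega> = x k) = P (x n) y)"

(* Pr i is the law under which the chain X starts in state i *)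
definition markov_family ::
  "('s \<Rightarrow> 'w measure) \<Rightarrow> 's set \<Rightarrow> ('s \<Rightarrow> 's \<Rightarrow> real) \<Rightarrow> (nat \<Rightarrow> 'w \<Rightarrow> 's) \<Rightarrow> bool" where
  "markov_family Pr S P X \<longleftrightarrow>
     (\<forall>i\<in>S. markov_chain (Pr i) S P X \<and> \<P>(\<omega> in Pr i. X 0 \<omega> = i) = 1)"

(* the infimum of the empty set is \<infinity>: state i is never visited after time 0 *)
definition return_time :: "(nat \<Rightarrow> 'w \<Rightarrow> 's) \<Rightarrow> 's \<Rightarrow> 'w \<Rightarrow> enat" where
  "return_time X i \<omega> = (INF n\<in>{n. 1 \<le> n \<and> X n \<omega> = i}. enat n)"

definition null_recurrent_state ::
  "('s \<Rightarrow> 'w measure) \<Rightarrow> (nat \<Rightarrow> 'w \<Rightarrow> 's) \<Rightarrow> 's \<Rightarrow> bool" where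
  "null_recurrent_state Pr X i \<longleftrightarrow>
     \<P>(\<omega> in Pr i. return_time X i \<omega> < \<infinity>) = 1 \<and>
     (\<integral>\<^sup>+ \<omega>. ennreal_of_enat (return_time X i \<omega>) \<partial>Pr i) = \<infinity>"

definition null_recurrent ::
  "('s \<Rightarrow> 'w measure) \<Rightarrow> 's set \<Rightarrow> (nat \<Rightarrow> 'w \<Rightarrow> 's) \<Rightarrow> bool" where
  "null_recurrent Pr S X \<longleftrightarrow> (\<forall>i\<in>S. null_recurrent_state Pr X i)"

definition dist_fun :: "'a measure \<Rightarrow> ('a \<Rightarrow> nat) \<Rightarrow> nat \<Rightarrow> real" where
  "dist_fun M \<nu> j = \<P>(\<omega> in M. \<nu> \<omega> \<le> j)"

(* The probability that the maximum of i independent copies of \<nu> equals j.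
   Only used for i, j \<ge> 1, so that j - 1 is not truncated. *)
definition lamperti_matrix :: "'a measure \<Rightarrow> ('a \<Rightarrow> nat) \<Rightarrow> nat \<Rightarrow> nat \<Rightarrow> real" where
  "lamperti_matrix M \<nu> i j = dist_fun M \<nu> j ^ i - dist_fun M \<nu> (j - 1) ^ i"

end

theory Submission
  imports Defs
begin

text \<open>
  Fix a state \<open>s\<close> and let \<open>\<delta> j\<close> be the expected number of visits to \<open>j\<close> at the times
  \<open>1, 2, \<dots>, T\<close>, where \<open>T\<close> is the first return time to the starting point \<open>s\<close>. Conditioning on
  the last step gives \<open>\<delta> j = P s j + (\<Sum>i\<noteq>s. \<delta> i * P i j)\<close>, and recurrence says \<open>\<delta> s = 1\<close>, so
  \<open>\<delta>\<close> is invariant. All entries of the Lamperti matrix are positive: hence \<open>\<delta> j \<ge> P s j > 0\<close>, while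
  \<open>\<delta> i * P i s \<le> \<delta> s = 1\<close> makes \<open>\<delta> i\<close> finite.
\<close>

text \<open>All sums are manipulated in \<open>ennreal\<close>, as integrals over counting measure,
  where interchange needs no convergence. A finite integral of a nonnegative function means absolute
  summability, which brings the result back to real sums.\<close>

lemma has_sum_if_nn_integral_count_space:
  fixes f :: "'a \<Rightarrow> real"
  assumes "\<And>x. x \<in> A \<Longrightarrow> 0 \<le> f x" and "0 \<le> c"
    and "(\<integral>\<^sup>+x. ennreal (f x) \<partial>count_space A) = ennreal c"
  shows "(f has_sum c) A"
proof -
  have "integrable (count_space A) f \<and> integral\<^sup>L (count_space A) f = c"
    using assms by (subst nn_integral_eq_integrable[symmetric]) (auto simp: AE_count_space)
  then have "Infinite_Set_Sum.abs_summable_on f A" "infsetsum f A = c"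
    by (auto simp: abs_summable_on_def infsetsum_def)
  then have "f summable_on A" "infsum f A = c"
    using abs_summable_equivalent[of f A] infsetsum_infsum[of f A] abs_summable_summable[of f A]
    by auto
  then show ?thesis
    using has_sum_infsum by blast
qed

section \<open>The one-step Markov property given a set of histories\<close>

lemma markov_chain_measurable:
  assumes "markov_chain M S P X"
  shows "X n \<in> measurable M (count_space UNIV)"
proof -
  have "X n \<in> measurable M (count_space S)"
    using assms by (auto simp: markov_chain_def)
  then show ?thesis
    using measurable_compose[of "X n" M "count_space S" "\<lambda>x. x" "count_space UNIV"] by simp
qed

lemma markov_chain_in_states:
  assumes "markov_chain M S P X" "\<omega> \<in> space M"
  shows "X n \<omega> \<in> S"
proof -
  have "X n \<in> measurable M (count_space S)"
    using assms by (auto simp: markov_chain_def)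
  from measurable_space[OF this assms(2)] show ?thesis by simp
qed

text \<open>The product form of the Markov property avoids conditioning, so it also covers histories
  of probability zero, where both sides vanish.\<close>

lemma markov_chain_path_step:
  assumes mc: "markov_chain M S P X" and x: "\<And>k. k \<le> n \<Longrightarrow> x k \<in> S" and y: "y \<in> S"
  shows "emeasure M {\<omega> \<in> space M. X (Suc n) \<omega> = y \<and> (\<forall>k\<le>n. X k \<omega> = x k)}
    = emeasure M {\<omega> \<in> space M. \<forall>k\<le>n. X k \<omega> = x k} * ennreal (P (x n) y)"
proof -
  interpret prob_space M using mc by (simp add: markov_chain_def)
  note [measurable] = markov_chain_measurable[OF mc]
  let ?H = "{\<omega> \<in> space M. \<forall>k\<le>n. X k \<omega> = x k}"
  let ?HY = "{\<omega> \<in> space M. X (Suc n) \<omega> = y \<and> (\<forall>k\<le>n. X k \<omega> = x k)}"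
  have [measurable]: "?H \<in> sets M" "?HY \<in> sets M" by measurable
  show ?thesis
  proof (cases "prob ?H > 0")
    case True
    then have "prob ?HY / prob ?H = P (x n) y"
      using mc x y unfolding markov_chain_def cond_prob_def by auto
    with True have "prob ?HY = prob ?H * P (x n) y" by (simp add: field_simps)
    then show ?thesis
      by (simp add: emeasure_eq_measure ennreal_mult')
  next
    case False
    then have 0: "prob ?H = 0" by (simp add: order.antisym not_less)
    have "prob ?HY \<le> prob ?H" by (rule finite_measure_mono) auto
    with 0 have "prob ?HY = 0" by (simp add: measure_le_0_iff)
    with 0 show ?thesis by (simp add: emeasure_eq_measure)
  qed
qed

text \<open>An event about the first \<open>n\<close> steps is a countable disjoint union of single
  paths. As every path in \<open>H\<close> ends in \<open>i\<close>, all of them share the factor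
  \<open>P i y\<close>, which comes out of the sum.\<close>

lemma markov_chain_history_step:
  assumes mc: "markov_chain M S P X" and S: "countable S" and y: "y \<in> S"
    and H: "\<And>x. x \<in> H \<Longrightarrow> x n = i"
  shows "emeasure M {\<omega> \<in> space M. X (Suc n) \<omega> = y \<and> (\<lambda>k\<in>{..n}. X k \<omega>) \<in> H}
    = emeasure M {\<omega> \<in> space M. (\<lambda>k\<in>{..n}. X k \<omega>) \<in> H} * ennreal (P i y)"
proof -
  note [measurable] = markov_chain_measurable[OF mc]
  \<comment> \<open>\<open>H\<close> itself may be uncountable. Its extensional
    \<open>S\<close>-valued members form a countable set, having finitely many coordinates in a
    countable set, and they are the only histories that occur.\<close>
  define G where "G = H \<inter> ({..n} \<rightarrow>\<^sub>E S)"
  define E where "E x = {\<omega> \<in> space M. \<forall>k\<le>n. X k \<omega> = x k}" for x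
  define EY where "EY x = {\<omega> \<in> space M. X (Suc n) \<omega> = y \<and> (\<forall>k\<le>n. X k \<omega> = x k)}" for x
  have G: "countable G"
    unfolding G_def using S by (intro countable_Int2 countable_PiE) auto
  have restrict_eq: "(\<lambda>k\<in>{..n}. X k \<omega>) = x \<longleftrightarrow> (\<forall>k\<le>n. X k \<omega> = x k)"
    if "x \<in> G" for x \<omega>
    using that by (auto simp: G_def PiE_def extensional_def fun_eq_iff restrict_def)
  have inG: "(\<lambda>k\<in>{..n}. X k \<omega>) \<in> H \<longleftrightarrow> (\<exists>x\<in>G. \<forall>k\<le>n. X k \<omega> = x k)"
    if "\<omega> \<in> space M" for \<omega>
  proof -
    have "(\<lambda>k\<in>{..n}. X k \<omega>) \<in> H \<longleftrightarrow> (\<lambda>k\<in>{..n}. X k \<omega>) \<in> G"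
      using markov_chain_in_states[OF mc that] by (auto simp: G_def)
    also have "\<dots> \<longleftrightarrow> (\<exists>x\<in>G. (\<lambda>k\<in>{..n}. X k \<omega>) = x)" by blast
    finally show ?thesis using restrict_eq by blast
  qed
  have disjE: "disjoint_family_on E G"
    unfolding disjoint_family_on_def
  proof (intro ballI impI equals0I)
    fix x x' \<omega> assume G: "x \<in> G" "x' \<in> G" and "x \<noteq> x'" and "\<omega> \<in> E x \<inter> E x'"
    then have "\<forall>k\<le>n. X k \<omega> = x k" "\<forall>k\<le>n. X k \<omega> = x' k"
      unfolding E_def by blast+
    then have "(\<lambda>k\<in>{..n}. X k \<omega>) = x" "(\<lambda>k\<in>{..n}. X k \<omega>) = x'"
      unfolding restrict_eq[OF G(1)] restrict_eq[OF G(2)] by blast+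
    with \<open>x \<noteq> x'\<close> show False by (metis (no_types))
  qed
  have "EY x \<subseteq> E x" for x
    by (auto simp: E_def EY_def)
  with disjE have disjEY: "disjoint_family_on EY G"
    unfolding disjoint_family_on_def by blast
  have "{\<omega> \<in> space M. X (Suc n) \<omega> = y \<and> (\<lambda>k\<in>{..n}. X k \<omega>) \<in> H} = (\<Union>x\<in>G. EY x)"
    using inG unfolding EY_def by blast
  then have "emeasure M {\<omega> \<in> space M. X (Suc n) \<omega> = y \<and> (\<lambda>k\<in>{..n}. X k \<omega>) \<in> H}
      = (\<integral>\<^sup>+x. emeasure M (EY x) \<partial>count_space G)"
    using emeasure_UN_countable[OF _ G disjEY] by (simp add: EY_def)
  also have "\<dots> = (\<integral>\<^sup>+x. emeasure M (E x) * ennreal (P i y) \<partial>count_space G)"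
  proof (rule nn_integral_cong)
    fix x assume "x \<in> space (count_space G)"
    then have x: "x \<in> G" by simp
    have "emeasure M (EY x) = emeasure M (E x) * ennreal (P (x n) y)"
      unfolding E_def EY_def using x
      by (intro markov_chain_path_step[OF mc _ y]) (auto simp: G_def)
    then show "emeasure M (EY x) = emeasure M (E x) * ennreal (P i y)"
      using x H[of x] by (simp add: G_def)
  qed
  also have "\<dots> = (\<integral>\<^sup>+x. emeasure M (E x) \<partial>count_space G) * ennreal (P i y)"
    by (rule nn_integral_multc) simp
  also have "(\<integral>\<^sup>+x. emeasure M (E x) \<partial>count_space G) = emeasure M (\<Union>x\<in>G. E x)"
    by (rule emeasure_UN_countable[symmetric, OF _ G disjE]) (simp add: E_def)
  also have "(\<Union>x\<in>G. E x) = {\<omega> \<in> space M. (\<lambda>k\<in>{..n}. X k \<omega>) \<in> H}"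
    using inG unfolding E_def by blast
  finally show ?thesis .
qed

section \<open>The excursion measure of a recurrent state\<close>

lemma return_time_finite_iff:
  "return_time X i \<omega> < \<infinity> \<longleftrightarrow> (\<exists>n. X (Suc n) \<omega> = i)"
proof -
  have "return_time X i \<omega> < \<infinity> \<longleftrightarrow> (\<exists>n\<ge>1. X n \<omega> = i)"
    unfolding return_time_def INF_less_iff by auto
  also have "\<dots> \<longleftrightarrow> (\<exists>n. X (Suc n) \<omega> = i)"
    by (metis Suc_le_D One_nat_def le_add1 plus_1_eq_Suc)
  finally show ?thesis .
qed

theorem recurrent_positive_chain_invariant_measure:
  fixes Pr :: "'s \<Rightarrow> 'w measure" and X :: "nat \<Rightarrow> 'w \<Rightarrow> 's"
  assumes S: "countable S" and s: "s \<in> S"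
    and fam: "markov_family Pr S P X"
    and pos: "\<And>i j. i \<in> S \<Longrightarrow> j \<in> S \<Longrightarrow> 0 < P i j"
    and rec: "\<P>(\<omega> in Pr s. return_time X s \<omega> < \<infinity>) = 1"
  shows "\<exists>\<delta> :: 's \<Rightarrow> real. (\<forall>j\<in>S. 0 < \<delta> j) \<and>
    (\<forall>j\<in>S. ((\<lambda>i. \<delta> i * P i j) has_sum \<delta> j) S)"
proof -
  define M where "M = Pr s"
  have mc: "markov_chain M S P X" and start: "\<P>(\<omega> in M. X 0 \<omega> = s) = 1"
    using fam s by (auto simp: markov_family_def M_def)
  interpret prob_space M using mc by (simp add: markov_chain_def)
  note [measurable] = markov_chain_measurable[OF mc]
  note in_S = markov_chain_in_states[OF mc]
  \<comment> \<open>With \<open>T\<close> the return time to \<open>s\<close>, \<open>V n j\<close>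
    is the event that \<open>X (Suc n) = j\<close> and \<open>Suc n \<le> T\<close>. So
    \<open>d j\<close> is the expected number of visits in the overview, a priori possibly
    infinite.\<close>
  define V where "V n j = {\<omega> \<in> space M. X (Suc n) \<omega> = j \<and> (\<forall>k\<in>{1..n}. X k \<omega> \<noteq> s)}" for n j
  define f where "f n j = emeasure M (V n j)" for n j
  define d where "d j = (\<Sum>n. f n j)" for j
  have V[measurable]: "V n j \<in> sets M" for n j
    unfolding V_def by measurable
  have f0: "f 0 j = ennreal (P s j)" if j: "j \<in> S" for j
  proof -
    have sets: "{\<omega> \<in> space M. X 0 \<omega> = s} \<in> sets M" by measurable
    have one: "emeasure M {\<omega> \<in> space M. X 0 \<omega> = s} = 1"
      using start by (simp add: emeasure_eq_measure)
    \<comment> \<open>The start in \<open>s\<close> is only almost sure, so it is inserted into the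
      event up to a null set. For \<open>n = 0\<close> the avoidance condition is empty.\<close>
    have "AE \<omega> in M. X 0 \<omega> = s"
      using start sets by (simp add: prob_Collect_eq_1)
    then have "f 0 j = emeasure M {\<omega> \<in> space M. X (Suc 0) \<omega> = j \<and> (\<lambda>k\<in>{..0}. X k \<omega>) \<in> {x. x 0 = s}}"
      unfolding f_def V_def by (intro emeasure_eq_AE) auto
    also have "\<dots> = emeasure M {\<omega> \<in> space M. (\<lambda>k\<in>{..0}. X k \<omega>) \<in> {x. x 0 = s}} * ennreal (P s j)"
      by (rule markov_chain_history_step[OF mc S j]) simp
    finally show ?thesis using one by simp
  qed
  have fSuc: "f (Suc n) j = (\<integral>\<^sup>+i. f n i * ennreal (P i j) \<partial>count_space (S - {s}))"
    if j: "j \<in> S" for n j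
  proof -
    define W where "W i = {\<omega> \<in> space M. X (Suc (Suc n)) \<omega> = j \<and> X (Suc n) \<omega> = i \<and>
      (\<forall>k\<in>{1..n}. X k \<omega> \<noteq> s)}" for i
    have [measurable]: "W i \<in> sets M" for i unfolding W_def by measurable
    \<comment> \<open>Split by the state at time \<open>Suc n\<close>; avoiding \<open>s\<close> up
      to that time excludes exactly \<open>i = s\<close>.\<close>
    have "V (Suc n) j = (\<Union>i\<in>S - {s}. W i)"
      using in_S unfolding V_def W_def by (auto simp: atLeastAtMostSuc_conv)
    moreover have "disjoint_family_on W (S - {s})"
      by (auto simp: disjoint_family_on_def W_def)
    ultimately have "f (Suc n) j = (\<integral>\<^sup>+i. emeasure M (W i) \<partial>count_space (S - {s}))"
      using S by (simp add: f_def emeasure_UN_countable)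
    also have "\<dots> = (\<integral>\<^sup>+i. f n i * ennreal (P i j) \<partial>count_space (S - {s}))"
    proof (rule nn_integral_cong)
      fix i
      let ?H = "{x. x (Suc n) = i \<and> (\<forall>k\<in>{1..n}. x k \<noteq> s)}"
      have "W i = {\<omega> \<in> space M. X (Suc (Suc n)) \<omega> = j \<and> (\<lambda>k\<in>{..Suc n}. X k \<omega>) \<in> ?H}"
        and "V n i = {\<omega> \<in> space M. (\<lambda>k\<in>{..Suc n}. X k \<omega>) \<in> ?H}"
        by (auto simp: W_def V_def)
      then show "emeasure M (W i) = f n i * ennreal (P i j)"
        unfolding f_def using markov_chain_history_step[OF mc S j, of ?H "Suc n" i] by simp
    qed
    finally show ?thesis .
  qed
  \<comment> \<open>\<open>V n s\<close> is the event \<open>T = Suc n\<close>, so the series adds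
    up to the probability of a finite return time.\<close>
  have ds: "d s = 1"
  proof -
    have "disjoint_family (\<lambda>n. V n s)"
      unfolding disjoint_family_on_def
    proof (intro ballI impI)
      fix m n :: nat assume "m \<noteq> n"
      \<comment> \<open>The event with the larger index forbids the visit to \<open>s\<close> that
        the other one requires.\<close>
      then have "Suc m \<in> {1..n} \<or> Suc n \<in> {1..m}" by auto
      then show "V m s \<inter> V n s = {}" by (auto simp: V_def)
    qed
    then have "d s = emeasure M (\<Union>n. V n s)"
      unfolding d_def f_def by (intro suminf_emeasure) auto
    also have "(\<Union>n. V n s) = {\<omega> \<in> space M. return_time X s \<omega> < \<infinity>}"
    proof -
      have "\<exists>n. \<omega> \<in> V n s" if \<omega>: "\<omega> \<in> space M" and ret: "\<exists>n. X (Suc n) \<omega> = s" for \<omega>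
      proof -
        \<comment> \<open>The least index is taken over shifted times, so that time 0, where the
          chain starts in \<open>s\<close>, does not count as a return.\<close>
        define n where "n = (LEAST n. X (Suc n) \<omega> = s)"
        have "X (Suc n) \<omega> = s" unfolding n_def by (rule LeastI_ex[OF ret])
        moreover have "X k \<omega> \<noteq> s" if "k \<in> {1..n}" for k
        proof -
          from that have "k - 1 < n" "Suc (k - 1) = k" by auto
          then show ?thesis
            using not_less_Least[of "k - 1" "\<lambda>n. X (Suc n) \<omega> = s"] by (simp add: n_def)
        qed
        ultimately show ?thesis using \<omega> by (auto simp: V_def)
      qed
      moreover have "\<omega> \<in> space M \<and> X (Suc n) \<omega> = s" if "\<omega> \<in> V n s" for n \<omega>
        using that by (simp add: V_def)
      ultimately show ?thesis unfolding return_time_finite_iff by blast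
    qed
    also have "emeasure M \<dots> = 1"
      using rec by (simp add: emeasure_eq_measure M_def[symmetric])
    finally show ?thesis .
  qed
  have inv: "(\<integral>\<^sup>+i. d i * ennreal (P i j) \<partial>count_space S) = d j" if j: "j \<in> S" for j
  proof -
    \<comment> \<open>The term \<open>i = s\<close> equals \<open>f 0 j\<close> because
      \<open>d s = 1\<close>; this is where recurrence enters. The terms \<open>i \<noteq> s\<close>
      sum to the remaining \<open>f (Suc n) j\<close> by the last-step decomposition.\<close>
    have "(\<integral>\<^sup>+i. d i * ennreal (P i j) \<partial>count_space S)
        = (\<integral>\<^sup>+i. d i * ennreal (P i j) * indicator {s} i \<partial>count_space S)
          + (\<integral>\<^sup>+i. d i * ennreal (P i j) * indicator (S - {s}) i \<partial>count_space S)"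
      by (subst nn_integral_add[symmetric]) (auto intro!: nn_integral_cong split: split_indicator)
    also have "(\<integral>\<^sup>+i. d i * ennreal (P i j) * indicator {s} i \<partial>count_space S) = f 0 j"
      using s f0[OF j] ds by (subst nn_integral_indicator_singleton) auto
    also have "(\<integral>\<^sup>+i. d i * ennreal (P i j) * indicator (S - {s}) i \<partial>count_space S)
        = (\<integral>\<^sup>+i. d i * ennreal (P i j) \<partial>count_space (S - {s}))"
      by (subst nn_integral_restrict_space[symmetric])
        (auto simp: restrict_count_space intro!: arg_cong2[where f = nn_integral] arg_cong[where f = count_space])
    also have "\<dots> = (\<integral>\<^sup>+i. (\<Sum>n. f n i * ennreal (P i j)) \<partial>count_space (S - {s}))"
      by (simp add: d_def)
    also have "\<dots> = (\<Sum>n. \<integral>\<^sup>+i. f n i * ennreal (P i j) \<partial>count_space (S - {s}))"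
      by (rule nn_integral_suminf) simp
    also have "\<dots> = (\<Sum>n. f (Suc n) j)"
      using fSuc[OF j] by simp
    also have "f 0 j + \<dots> = d j"
      unfolding d_def by (subst suminf_offset[where i = 1]) auto
    finally show ?thesis .
  qed
  have d_pos: "0 < d j" if j: "j \<in> S" for j
  proof -
    have "0 < ennreal (P s j)" using pos[OF s j] by simp
    also have "\<dots> = (\<Sum>n\<in>{0}. f n j)" using f0[OF j] by simp
    also have "\<dots> \<le> d j" unfolding d_def by (rule sum_le_suminf) auto
    finally show ?thesis .
  qed
  have d_fin: "d i < \<top>" if i: "i \<in> S" for i
  proof (rule ccontr)
    assume "\<not> d i < \<top>"
    \<comment> \<open>Positivity of \<open>P i s\<close> is essential: in \<open>ennreal\<close>,
      \<open>\<top> * 0 = 0\<close>.\<close>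
    then have "d i * ennreal (P i s) = \<top>"
      using pos[OF i s] by (simp flip: less_top add: ennreal_top_mult)
    moreover have "d i * ennreal (P i s) \<le> d s"
      using nn_integral_ge_point[OF i, of "\<lambda>i. d i * ennreal (P i s)"] inv[OF s] by simp
    ultimately show False using ds by (simp add: top_unique)
  qed
  \<comment> \<open>\<open>enn2real\<close> sends \<open>\<top>\<close> to 0, so it is faithful on
    \<open>S\<close> only thanks to \<open>d_fin\<close>.\<close>
  define \<delta> where "\<delta> j = enn2real (d j)" for j
  have \<delta>: "ennreal (\<delta> j) = d j" if "j \<in> S" for j
    using d_fin[OF that] by (simp add: \<delta>_def)
  have \<delta>_pos: "0 < \<delta> j" if "j \<in> S" for j
    using d_pos[OF that] d_fin[OF that] by (simp add: \<delta>_def enn2real_positive_iff)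
  have "((\<lambda>i. \<delta> i * P i j) has_sum \<delta> j) S" if j: "j \<in> S" for j
  proof (rule has_sum_if_nn_integral_count_space)
    show "0 \<le> \<delta> i * P i j" if "i \<in> S" for i
      using \<delta>_pos[OF that] pos[OF that j] by simp
    show "0 \<le> \<delta> j" using \<delta>_pos[OF j] by simp
    have "(\<integral>\<^sup>+i. ennreal (\<delta> i * P i j) \<partial>count_space S)
        = (\<integral>\<^sup>+i. d i * ennreal (P i j) \<partial>count_space S)"
    proof (rule nn_integral_cong)
      fix i assume "i \<in> space (count_space S)"
      then have i: "i \<in> S" by simp
      show "ennreal (\<delta> i * P i j) = d i * ennreal (P i j)"
        using pos[OF i j] \<delta>_pos[OF i] \<delta>[OF i] by (simp add: ennreal_mult)
    qed
    then show "(\<integral>\<^sup>+i. ennreal (\<delta> i * P i j) \<partial>count_space S) = ennreal (\<delta> j)"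
      using inv[OF j] \<delta>[OF j] by simp
  qed
  with \<delta>_pos show ?thesis by blast
qed

text \<open>The atom of \<open>\<nu>\<close> at \<open>j\<close> makes the distribution function
  jump there, and raising to a power \<open>i \<ge> 1\<close> keeps the inequality strict.\<close>

lemma lamperti_matrix_pos:
  assumes "prob_space M" and "\<nu> \<in> measurable M (count_space UNIV)"
    and "\<P>(\<omega> in M. \<nu> \<omega> = j) > 0" and "1 \<le> i" and "1 \<le> j"
  shows "0 < lamperti_matrix M \<nu> i j"
proof -
  interpret prob_space M by fact
  note [measurable] = assms(2)
  have "{\<omega> \<in> space M. \<nu> \<omega> \<le> j} = {\<omega> \<in> space M. \<nu> \<omega> \<le> j - 1} \<union> {\<omega> \<in> space M. \<nu> \<omega> = j}"
    using \<open>1 \<le> j\<close> by auto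
  moreover have "{\<omega> \<in> space M. \<nu> \<omega> \<le> j - 1} \<inter> {\<omega> \<in> space M. \<nu> \<omega> = j} = {}"
    using \<open>1 \<le> j\<close> by auto
  ultimately have "dist_fun M \<nu> j = dist_fun M \<nu> (j - 1) + \<P>(\<omega> in M. \<nu> \<omega> = j)"
    unfolding dist_fun_def by (simp add: finite_measure_Union)
  then have "dist_fun M \<nu> (j - 1) < dist_fun M \<nu> j"
    using assms(3) by simp
  then have "dist_fun M \<nu> (j - 1) ^ i < dist_fun M \<nu> j ^ i"
    using \<open>1 \<le> i\<close> by (intro power_strict_mono) (auto simp: dist_fun_def)
  then show ?thesis by (simp add: lamperti_matrix_def)
qed

theorem proposition6:
  fixes M :: "'a measure" and \<nu> :: "'a \<Rightarrow> nat"
    and Pr :: "nat \<Rightarrow> 'w measure" and X :: "nat \<Rightarrow> 'w \<Rightarrow> nat"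
  assumes "prob_space M"
    and "\<nu> \<in> measurable M (count_space UNIV)"
    and "\<forall>j\<ge>1. \<P>(\<omega> in M. \<nu> \<omega> = j) > 0"
    and "((\<lambda>j. \<P>(\<omega> in M. \<nu> \<omega> = j)) has_sum 1) {1..}"
    and "markov_family Pr {1..} (lamperti_matrix M \<nu>) X"
    and "null_recurrent Pr {1..} X"
  shows "\<exists>\<delta> :: nat \<Rightarrow> real.
           (\<forall>j\<ge>1. 0 < \<delta> j) \<and>
           (\<forall>j\<ge>1. ((\<lambda>i. \<delta> i * lamperti_matrix M \<nu> i j) has_sum \<delta> j) {1..})"
proof -
  have "0 < lamperti_matrix M \<nu> i j" if "i \<in> {1..}" "j \<in> {1..}" for i j
    using that assms(1-3) by (intro lamperti_matrix_pos) auto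
  \<comment> \<open>State 1 serves as the base point of the excursions.\<close>
  moreover have "\<P>(\<omega> in Pr 1. return_time X 1 \<omega> < \<infinity>) = 1"
    using assms(6) by (simp add: null_recurrent_def null_recurrent_state_def)
  ultimately show ?thesis
    using recurrent_positive_chain_invariant_measure[of "{1..}" 1 Pr "lamperti_matrix M \<nu>" X]
      assms(5) by (simp add: Ball_def)
qed

end
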